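(* Let $k \geq 1$ be an integer, and suppose there are $k$ potential input values. Let $G$ be a network whose largest component has $h$ processors, where $h$ satisfies $$h + \left\lfloor \frac{|G|-h}{k} \right\rfloor > \frac{|G|}{2}.$$ Then there exists a successful majority agreement protocol for $G$.
   Context: A network $G$ is a finite nonempty (possibly disconnected) undirected graph whose vertices are called processors; $|G|$ is the number of processors, and the size of a component (connected component) is its number of processors. Fix a set $V$ of $k$ (distinct) potential values. All processors know the whole network and the protocol. Each processor $i$ is given an input value $v_i \in V$ and may communicate without limit (and without faults), but only with the processors in its own component, after which it outputs a value in $V$. Thus a (deterministic) protocol amounts to choosing, for each processor $i$, a function giving the output of $i$ in $V$ in terms of the inputs of all the processors in the component of $i$ (and of no other inputs); these functions may be arbitrary and may differ between processors. A protocol is a successful majority agreement protocol if for every assignment of inputs $(v_i)$ there is a value $v \in V$ such that: (i) strictly more than $|G|/2$ of the processors output $v$; and (ii) if all processors have the same input $v_c$, then $v = v_c$. *)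

theory Defs
  imports Complex_Main "Graph_Theory.Digraph_Component"
begin

(* Undirected graphs are the symmetric digraphs of locale graph (finite, no loops, no
   parallel arcs).  By symmetry, reachability is an equivalence on the vertices, so the
   strongly connected components are exactly the connected components: scc_of G i is the
   vertex set of the component of i, sccs_verts G the set of all component vertex sets. *)

definition network :: "('a, 'b) pre_digraph \<Rightarrow> bool" where
  "network G \<longleftrightarrow> graph G \<and> verts G \<noteq> {}"

definition largest_component_size :: "('a, 'b) pre_digraph \<Rightarrow> nat" where
  "largest_component_size G = Max (card ` pre_digraph.sccs_verts G)"

definition input_assignments :: "('a, 'b) pre_digraph \<Rightarrow> 'v set \<Rightarrow> ('a \<Rightarrow> 'v) set" where
  "input_assignments G V = (verts G \<rightarrow>\<^sub>E V)"

(* p i maps an assignment of inputs to the component of i to the output of i. *)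
definition protocol :: "('a, 'b) pre_digraph \<Rightarrow> 'v set \<Rightarrow> ('a \<Rightarrow> ('a \<Rightarrow> 'v) \<Rightarrow> 'v) \<Rightarrow> bool" where
  "protocol G V p \<longleftrightarrow> (\<forall>i \<in> verts G. p i \<in> (pre_digraph.scc_of G i \<rightarrow>\<^sub>E V) \<rightarrow> V)"

(* Restricting x hides the inputs outside the component of i from p i. *)
definition protocol_output ::
  "('a, 'b) pre_digraph \<Rightarrow> ('a \<Rightarrow> ('a \<Rightarrow> 'v) \<Rightarrow> 'v) \<Rightarrow> ('a \<Rightarrow> 'v) \<Rightarrow> 'a \<Rightarrow> 'v" where
  "protocol_output G p x i = p i (restrict x (pre_digraph.scc_of G i))"

definition successful_majority_agreement ::
  "('a, 'b) pre_digraph \<Rightarrow> 'v set \<Rightarrow> ('a \<Rightarrow> ('a \<Rightarrow> 'v) \<Rightarrow> 'v) \<Rightarrow> bool" where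
  "successful_majority_agreement G V p \<longleftrightarrow>
     protocol G V p \<and>
     (\<forall>x \<in> input_assignments G V. \<exists>v \<in> V.
        real (card {i \<in> verts G. protocol_output G p x i = v}) > real (card (verts G)) / 2 \<and>
        (\<forall>c \<in> V. (\<forall>i \<in> verts G. x i = c) \<longrightarrow> v = c))"

end

(* Every processor of a largest component C outputs the input of one fixed leader r in C.
   The processors outside C ignore their inputs: they are divided into k classes, one for each
   value, of at least floor((|G| - h)/k) processors each, and always output the value of their
   class.  Whatever value r holds, C and the class of that value form a majority.  If all inputs
   agree, then the input of r is the common value. *)
theory Submission
  imports Defs
begin

text \<open>Induction on \<open>V\<close>: \<open>q\<close> elements of \<open>A\<close> are set
  aside for the new value \<open>v\<close>, and the at least \<open>card V * q\<close> others are
  left to the induction hypothesis. The last value takes everything that remains, so leftover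
  elements are also mapped into \<open>V\<close>.\<close>

lemma exists_function_with_large_fibers:
  assumes "finite V" "V \<noteq> {}" "finite A" "card V * q \<le> card A"
  shows "\<exists>f \<in> A \<rightarrow> V. \<forall>v \<in> V. q \<le> card {a \<in> A. f a = v}"
  using assms
proof (induction V arbitrary: A rule: finite_ne_induct)
  case (singleton v)
  then show ?case
    by (intro bexI[of _ "\<lambda>_. v"]) auto
next
  case (insert v V)
  then have "q \<le> card A"
    by simp
  then obtain B where B: "B \<subseteq> A" "card B = q" "finite B"
    by (rule obtain_subset_with_card_n)
  then have "card V * q \<le> card (A - B)"
    using insert by (simp add: card_Diff_subset)
  then obtain f where f: "f \<in> A - B \<rightarrow> V" "\<forall>u \<in> V. q \<le> card {a \<in> A - B. f a = u}"
    using insert.IH[of "A - B"] insert.prems by auto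
  define g where "g a = (if a \<in> B then v else f a)" for a
  have "q \<le> card {a \<in> A. g a = u}" if "u \<in> insert v V" for u
  proof (cases "u = v")
    case True
    then have "B \<subseteq> {a \<in> A. g a = u}"
      using B by (auto simp: g_def)
    then have "card B \<le> card {a \<in> A. g a = u}"
      using insert.prems by (intro card_mono) auto
    then show ?thesis
      using B by simp
  next
    case False
    then have "q \<le> card {a \<in> A - B. f a = u}"
      using f that by blast
    also have "\<dots> \<le> card {a \<in> A. g a = u}"
      using insert.prems by (intro card_mono) (auto simp: g_def)
    finally show ?thesis .
  qed
  moreover have "g \<in> A \<rightarrow> insert v V"
    using f by (fastforce simp: g_def Pi_iff)
  ultimately show ?case
    by blast
qed

lemma (in fin_digraph) largest_component_obtain:
  assumes "verts G \<noteq> {}"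
  obtains r where "r \<in> verts G" "card (scc_of r) = largest_component_size G"
proof -
  have "largest_component_size G \<in> card ` sccs_verts"
    unfolding largest_component_size_def
    using assms by (intro Max_in) (auto simp: finite_sccs_verts sccs_verts_conv_scc_of)
  then show ?thesis
    using that by (auto simp: sccs_verts_conv_scc_of)
qed

theorem theorem1:
  fixes G :: "('a, 'b) pre_digraph" and V :: "'v set" and k h :: nat
  assumes "k \<ge> 1"
    and "finite V" and "card V = k"
    and "network G"
    and "h = largest_component_size G"
    and "real h + real_of_int \<lfloor>(real (card (verts G)) - real h) / real k\<rfloor>
           > real (card (verts G)) / 2"
  shows "\<exists>p. successful_majority_agreement G V p"
proof -
  interpret graph G
    using assms by (simp add: network_def)
  obtain r where r: "r \<in> verts G" and h: "card (scc_of r) = h"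
    using largest_component_obtain assms by (auto simp: network_def)
  define C where "C = scc_of r"
  \<comment> \<open>All members of \<open>C\<close> see the same inputs, among them that of
    \<open>r\<close>; this makes \<open>x r\<close> a legitimate output for each of them.\<close>
  have scc_C: "scc_of i = C" if "i \<in> C" for i
    using that scc_of_eq by (simp add: C_def)
  have C: "C \<subseteq> verts G" "r \<in> C"
    using r sccs_verts_subsets[OF scc_of_in_sccs_verts] in_scc_of_self by (auto simp: C_def)
  then have fin: "finite C"
    using finite_subset finite_verts by blast
  define q where "q = (card (verts G) - h) div k"
  have "h \<le> card (verts G)"
    using C h by (auto simp: C_def intro: card_mono)
  \<comment> \<open>Since \<open>h \<le> card (verts G)\<close>, the truncated subtraction in
    \<open>q\<close> agrees with the real one, and \<open>div\<close> is the floor of the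
    quotient.\<close>
  then have "\<lfloor>(real (card (verts G)) - real h) / real k\<rfloor> = int q"
    by (simp add: q_def floor_divide_of_nat_eq flip: of_nat_diff)
  then have majority: "real (card (verts G)) / 2 < real (h + q)"
    using assms by simp
  \<comment> \<open>With \<open>n = card (verts G) - h\<close>, this is
    \<open>k * (n div k) \<le> n\<close>.\<close>
  have "card V * q \<le> card (verts G - C)"
    using C fin h assms by (simp add: q_def C_def card_Diff_subset)
  moreover have "V \<noteq> {}"
    using assms by auto
  ultimately obtain f where f: "f \<in> verts G - C \<rightarrow> V"
    and fibers: "\<And>v. v \<in> V \<Longrightarrow> q \<le> card {a \<in> verts G - C. f a = v}"
    using exists_function_with_large_fibers[of V "verts G - C" q] assms by auto
  define p where "p i x = (if i \<in> C then x r else f i)" for i and x :: "'a \<Rightarrow> 'v"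
  have "protocol G V p"
    unfolding protocol_def
    using C f scc_C by (auto simp: p_def PiE_iff Pi_iff)
  moreover have "real (card (verts G)) / 2 < real (card {i \<in> verts G. protocol_output G p x i = x r})"
    if "x r \<in> V" for x
  proof -
    have "h + q \<le> card C + card {a \<in> verts G - C. f a = x r}"
      using fibers[OF that] h by (simp add: C_def)
    also have "\<dots> = card (C \<union> {a \<in> verts G - C. f a = x r})"
      using fin by (intro card_Un_disjoint[symmetric]) auto
    \<comment> \<open>For \<open>i\<close> in \<open>C\<close>, the restriction of \<open>x\<close>
      to \<open>scc_of i = C\<close> keeps the value at \<open>r\<close>; outside \<open>C\<close>
      the output is \<open>f i\<close>.\<close>
    also have "\<dots> \<le> card {i \<in> verts G. protocol_output G p x i = x r}"
      using C scc_C by (intro card_mono) (auto simp: protocol_output_def p_def)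
    finally show ?thesis
      using majority by linarith
  qed
  ultimately have "successful_majority_agreement G V p"
    unfolding successful_majority_agreement_def input_assignments_def
    using r by (fastforce intro: bexI[of _ "x r" for x])
  then show ?thesis
    by blast
qed

end
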